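(* Let $\mathcal P_i,\mathcal P_{i+1}$ be reversible ergodic Markov chains on a finite state space $\Omega$ with stationary distributions $\pi_i,\pi_{i+1}$ satisfying $|\langle\pi_i|\pi_{i+1}\rangle|^2\ge p_i>0$. Let $\varepsilon_i^{\mathrm{FP}},\varepsilon_i^{\mathcal W}\in(0,1)$, and let $$U_i^{\mathrm{FP}}=\prod_{j=1}^{(L_i-1)/2}\mathcal S_{\beta_j}(\Pi_{\pi_{i+1}})\,\mathcal S_{\alpha_j}(\Pi_{\pi_i})$$ be the ideal fixed-point amplitude amplification (FPAA) unitary on $\mathcal H_A$, of odd sequence length $L_i$ and with phase angles $\{\alpha_j,\beta_j\}$, so that $D_{\mathrm{tr}}(U_i^{\mathrm{FP}}|\pi_i\rangle,|\pi_{i+1}\rangle)\le\varepsilon_i^{\mathrm{FP}}$. Let $$\widetilde U_i^{\mathrm{FP}}=\prod_{j=1}^{(L_i-1)/2}\widetilde{\mathcal S}_{i+1,\beta_j}(\Pi_0)\,\widetilde{\mathcal S}_{i,\alpha_j}(\Pi_0)$$ be the corresponding GQSP-based FPAA unitary on $\mathcal H_s\otimes\mathcal H_A\otimes\mathcal H_B$, with the factors in the same order and each compiled selective phase of accuracy $\varepsilon_i^{\mathcal W}$. Then $$D_{\mathrm{tr}}\bigl(\widetilde U_i^{\mathrm{FP}}\mathcal J|\pi_i\rangle,\ \mathcal J|\pi_{i+1}\rangle\bigr)\le 2(L_i-1)\,\varepsilon_i^{\mathcal W}+\varepsilon_i^{\mathrm{FP}}.$$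
   Context: GQSP stands for generalized quantum signal processing. For normalized pure states, $D_{\mathrm{tr}}(|\alpha\rangle,|\beta\rangle):=\sqrt{1-|\langle\alpha|\beta\rangle|^2}$. For a probability distribution $\pi$ on $\Omega$, $|\pi\rangle:=\sum_x\sqrt{\pi(x)}|x\rangle\in\mathcal H_A$ and $\Pi_\pi:=|\pi\rangle\langle\pi|$. For an orthogonal projector $\Pi$, $\mathcal S_\phi(\Pi):=\mathbb I+(e^{i\phi}-1)\Pi$. Registers $A,B$ (each of $\lceil\log_2|\Omega|\rceil$ qubits) have state spaces $\mathcal H_A,\mathcal H_B$ with basis indexed by $\Omega$, $|0\rangle_B$ is the all-zeros reference basis state of $B$, and $\mathcal H_s\cong\mathbb C^2$ is a signal qubit. The embedding $\mathcal J:\mathcal H_A\to\mathcal H_s\otimes\mathcal H_A\otimes\mathcal H_B$ is $\mathcal J|v\rangle:=|0\rangle_s|v\rangle_A|0\rangle_B$. For a chain $\mathcal P$ with transition matrix $P$: $\mathcal T|x\rangle:=|x\rangle\sum_y\sqrt{P(x,y)}|y\rangle$, $S|x\rangle|y\rangle:=|y\rangle|x\rangle$, and the qubitized Szegedy walk is $\mathcal W:=(2\mathcal T\mathcal T^\dagger-\mathbb I)S$, with $\Pi_0$ the orthogonal projector onto $\ker(\mathcal W-\mathbb I)$. Its phase gap is $\Delta_{\mathcal W}:=\min\{|\theta|:\theta\ne0,\ e^{i\theta}\in\mathrm{spec}(\mathcal W),\ \theta\in(-\pi,\pi]\}$. The oracle $O_{\mathcal P}$ is a unitary on $\mathcal H_A\otimes\mathcal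 H_B$ with $O_{\mathcal P}|x\rangle|0\rangle=\sum_y\sqrt{P(x,y)}|x\rangle|y\rangle$ for all $x$. For $\eta\in(0,1)$, $\mathcal C_{\Delta_{\mathcal W},\eta}(\mathcal W)$ is the GQSP unitary on $\mathcal H_s\otimes\mathcal H_A\otimes\mathcal H_B$ with $\mathcal C_{\Delta_{\mathcal W},\eta}(\mathcal W)(|0\rangle_s\otimes\mathbb I_{AB})=|0\rangle_s\otimes\Upsilon(\mathcal W)+|1\rangle_s\otimes\Phi(\mathcal W)$, where $\Upsilon,\Phi\in\mathbb C[x]$, $\Upsilon(1)=1$, $|\Upsilon(e^{i\theta})|\le\eta$ for every eigenvalue $e^{i\theta}\neq1$ of $\mathcal W$ (hence $\|\Upsilon(\mathcal W)-\Pi_0\|\le\eta$), and $\Upsilon(\mathcal W)^\dagger\Upsilon(\mathcal W)+\Phi(\mathcal W)^\dagger\Phi(\mathcal W)=\mathbb I$. With $P_\phi:=e^{i\phi}|0\rangle\langle0|+|1\rangle\langle1|$ on the signal qubit, the compiled selective phase of accuracy $\eta$ is $$\widetilde{\mathcal S}_\phi(\Pi_0):=(\mathbb I_s\otimes O_{\mathcal P}^\dagger)\,\mathcal C_{\Delta_{\mathcal W},\eta}(\mathcal W)^\dagger(P_\phi\otimes\mathbb I_{AB})\,\mathcal C_{\Delta_{\mathcal W},\eta}(\mathcal W)\,(\mathbb I_s\otimes O_{\mathcal P}).$$ $\widetilde{\mathcal S}_{k,\phi}(\Pi_0)$ denotes this construction for the chain $\mathcal P_k$, $k\in\{i,i+1\}$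 (with its own walk, oracle and projector $\Pi_0$). The existence of an ideal FPAA unitary is a known theorem of Yoder, Low and Chuang: for any $\varepsilon_i^{\mathrm{FP}}\in(0,1)$ suitable angles exist for some odd $L_i=\mathcal O(p_i^{-1/2}\log(1/\varepsilon_i^{\mathrm{FP}}))$. *)

theory Defs
  imports "HOL-Analysis.Analysis" "HOL-Computational_Algebra.Polynomial"
begin

section \<open>Finite-dimensional complex linear algebra\<close>

text \<open>
  The Hilbert space with orthonormal basis indexed by a finite type \<open>'n\<close> is \<open>complex ^ 'n\<close>;
  a tensor product of two such spaces is indexed by the product type, and an operator from
  \<open>complex ^ 'n\<close> to \<open>complex ^ 'm\<close> is a matrix of type \<open>complex ^ 'n ^ 'm\<close>.
\<close>

definition ket :: "'n::finite \<Rightarrow> complex ^ 'n" where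
  "ket x = axis x 1"

definition braket :: "complex ^ 'n \<Rightarrow> complex ^ 'n \<Rightarrow> complex" where
  "braket u v = (\<Sum>i\<in>UNIV. cnj (u $ i) * v $ i)"

definition ketbra :: "complex ^ 'm \<Rightarrow> complex ^ 'n \<Rightarrow> complex ^ 'n ^ 'm" where
  "ketbra u v = (\<chi> i j. u $ i * cnj (v $ j))"

definition dagger :: "complex ^ 'n ^ 'm \<Rightarrow> complex ^ 'm ^ 'n" where
  "dagger A = (\<chi> i j. cnj (A $ j $ i))"

definition unitary :: "complex ^ 'n ^ 'n \<Rightarrow> bool" where
  "unitary U \<longleftrightarrow> dagger U ** U = mat 1 \<and> U ** dagger U = mat 1"

definition smult_mat :: "complex \<Rightarrow> complex ^ 'n ^ 'm \<Rightarrow> complex ^ 'n ^ 'm" where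
  "smult_mat c A = (\<chi> i j. c * A $ i $ j)"

definition tensor_vec :: "complex ^ 'a \<Rightarrow> complex ^ 'b \<Rightarrow> complex ^ ('a \<times> 'b)" where
  "tensor_vec u v = (\<chi> p. u $ fst p * v $ snd p)"

definition tensor_mat ::
  "complex ^ 'a ^ 'c \<Rightarrow> complex ^ 'b ^ 'd \<Rightarrow> complex ^ ('a \<times> 'b) ^ ('c \<times> 'd)" where
  "tensor_mat A B = (\<chi> p q. A $ fst p $ fst q * B $ snd p $ snd q)"

text \<open>The operator \<open>v \<mapsto> u \<otimes> A v\<close>, written \<open>|u\<rangle> \<otimes> A\<close>.\<close>

definition tensor_ket_mat ::
  "complex ^ 's \<Rightarrow> complex ^ 'n ^ 'm \<Rightarrow> complex ^ 'n ^ ('s \<times> 'm)" where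
  "tensor_ket_mat u A = (\<chi> p j. u $ fst p * A $ snd p $ j)"

text \<open>The library's \<open>*\<close> and \<open>^\<close> on matrices act componentwise, so matrix powers are iterated
  matrix products.\<close>

definition mat_pow :: "'a::semiring_1 ^ 'n ^ 'n \<Rightarrow> nat \<Rightarrow> 'a ^ 'n ^ 'n" where
  "mat_pow A k = ((\<lambda>M. A ** M) ^^ k) (mat 1)"

definition poly_mat :: "complex poly \<Rightarrow> complex ^ 'n ^ 'n \<Rightarrow> complex ^ 'n ^ 'n" where
  "poly_mat p A = (\<Sum>k\<le>degree p. smult_mat (coeff p k) (mat_pow A k))"

definition eigenvalue_of :: "complex ^ 'n ^ 'n \<Rightarrow> complex \<Rightarrow> bool" where
  "eigenvalue_of A z \<longleftrightarrow> (\<exists>v. v \<noteq> 0 \<and> A *v v = z *s v)"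

text \<open>The ordered product over \<open>j = 1, \<dots>, m\<close>, factor 1 leftmost.\<close>

definition mat_prod :: "nat \<Rightarrow> (nat \<Rightarrow> complex ^ 'n ^ 'n) \<Rightarrow> complex ^ 'n ^ 'n" where
  "mat_prod m F = foldr (\<lambda>j M. F j ** M) [1..<Suc m] (mat 1)"

text \<open>Meaningful for normalized vectors only.\<close>

definition trace_dist :: "complex ^ 'n \<Rightarrow> complex ^ 'n \<Rightarrow> real" where
  "trace_dist u v = sqrt (1 - (cmod (braket u v))\<^sup>2)"


section \<open>Markov chains on a finite state space\<close>

definition stochastic :: "real ^ 'w ^ 'w \<Rightarrow> bool" where
  "stochastic P \<longleftrightarrow> (\<forall>x y. 0 \<le> P $ x $ y) \<and> (\<forall>x. (\<Sum>y\<in>UNIV. P $ x $ y) = 1)"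

definition chain_irreducible :: "real ^ 'w ^ 'w \<Rightarrow> bool" where
  "chain_irreducible P \<longleftrightarrow> (\<forall>x y. \<exists>n. 0 < mat_pow P n $ x $ y)"

definition chain_aperiodic :: "real ^ 'w ^ 'w \<Rightarrow> bool" where
  "chain_aperiodic P \<longleftrightarrow> (\<forall>x. Gcd {n. 0 < n \<and> 0 < mat_pow P n $ x $ x} = 1)"

definition ergodic_chain :: "real ^ 'w ^ 'w \<Rightarrow> bool" where
  "ergodic_chain P \<longleftrightarrow> stochastic P \<and> chain_irreducible P \<and> chain_aperiodic P"

definition prob_vec :: "real ^ 'w \<Rightarrow> bool" where
  "prob_vec \<pi> \<longleftrightarrow> (\<forall>x. 0 \<le> \<pi> $ x) \<and> (\<Sum>x\<in>UNIV. \<pi> $ x) = 1"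

definition stationary_dist :: "real ^ 'w ^ 'w \<Rightarrow> real ^ 'w \<Rightarrow> bool" where
  "stationary_dist P \<pi> \<longleftrightarrow> prob_vec \<pi> \<and> \<pi> v* P = \<pi>"

definition reversible_wrt :: "real ^ 'w ^ 'w \<Rightarrow> real ^ 'w \<Rightarrow> bool" where
  "reversible_wrt P \<pi> \<longleftrightarrow> (\<forall>x y. \<pi> $ x * P $ x $ y = \<pi> $ y * P $ y $ x)"

definition qsample :: "real ^ 'w \<Rightarrow> complex ^ 'w" where
  "qsample \<pi> = (\<Sum>x\<in>UNIV. complex_of_real (sqrt (\<pi> $ x)) *s ket x)"

definition sample_proj :: "real ^ 'w \<Rightarrow> complex ^ 'w ^ 'w" where
  "sample_proj \<pi> = ketbra (qsample \<pi>) (qsample \<pi>)"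


section \<open>The qubitized Szegedy walk\<close>

definition szegedy_T :: "real ^ 'w ^ 'w \<Rightarrow> complex ^ 'w ^ ('w \<times> 'w)" where
  "szegedy_T P = (\<chi> p x.
     tensor_vec (ket x) (\<Sum>y\<in>UNIV. complex_of_real (sqrt (P $ x $ y)) *s ket y) $ p)"

definition swap_op :: "complex ^ ('w::finite \<times> 'w) ^ ('w \<times> 'w)" where
  "swap_op = (\<chi> p q. tensor_vec (ket (snd q)) (ket (fst q)) $ p)"

definition szegedy_walk :: "real ^ 'w ^ 'w \<Rightarrow> complex ^ ('w \<times> 'w) ^ ('w \<times> 'w)" where
  "szegedy_walk P =
     (smult_mat 2 (szegedy_T P ** dagger (szegedy_T P)) - mat 1) ** swap_op"

text \<open>In what follows \<open>z\<close> is the label of the reference basis state \<open>|0\<rangle>\<close> of register \<open>B\<close>,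
  an arbitrary element of the state space.\<close>

definition is_oracle ::
  "'w \<Rightarrow> real ^ 'w ^ 'w \<Rightarrow> complex ^ ('w \<times> 'w) ^ ('w \<times> 'w) \<Rightarrow> bool" where
  "is_oracle z P Q \<longleftrightarrow> unitary Q \<and>
     (\<forall>x. Q *v tensor_vec (ket x) (ket z) =
       (\<Sum>y\<in>UNIV. complex_of_real (sqrt (P $ x $ y)) *s tensor_vec (ket x) (ket y)))"


section \<open>Selective phases and amplitude amplification\<close>

definition sel_phase :: "real \<Rightarrow> complex ^ 'n ^ 'n \<Rightarrow> complex ^ 'n ^ 'n" where
  "sel_phase \<phi> A = mat 1 + smult_mat (cis \<phi> - 1) A"

text \<open>\<open>is_gqsp W \<eta> C\<close>: the unitary \<open>C\<close> on signal qubit and system is a GQSP unitary for \<open>W\<close>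
  whose polynomial fixes the eigenvalue 1 and suppresses every other eigenvalue to modulus at
  most \<open>\<eta>\<close>.  As the suppression is required on the spectrum itself, the phase gap of \<open>W\<close>, which
  only governs the polynomial degree, does not occur.\<close>

definition is_gqsp ::
  "complex ^ 'n ^ 'n \<Rightarrow> real \<Rightarrow> complex ^ (2 \<times> 'n) ^ (2 \<times> 'n) \<Rightarrow> bool" where
  "is_gqsp W \<eta> C \<longleftrightarrow> unitary C \<and>
     (\<exists>\<Upsilon> \<Phi> :: complex poly.
        C ** tensor_ket_mat (ket 0) (mat 1) =
          tensor_ket_mat (ket 0) (poly_mat \<Upsilon> W) + tensor_ket_mat (ket 1) (poly_mat \<Phi> W) \<and>
        poly \<Upsilon> 1 = 1 \<and>
        (\<forall>\<theta>::real. eigenvalue_of W (cis \<theta>) \<and> cis \<theta> \<noteq> 1 \<longrightarrow> cmod (poly \<Upsilon> (cis \<theta>)) \<le> \<eta>) \<and>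
        dagger (poly_mat \<Upsilon> W) ** poly_mat \<Upsilon> W + dagger (poly_mat \<Phi> W) ** poly_mat \<Phi> W = mat 1)"

definition signal_phase :: "real \<Rightarrow> complex ^ 2 ^ 2" where
  "signal_phase \<phi> = smult_mat (cis \<phi>) (ketbra (ket 0) (ket 0)) + ketbra (ket 1) (ket 1)"

definition compiled_phase ::
  "complex ^ 'n ^ 'n \<Rightarrow> complex ^ (2 \<times> 'n) ^ (2 \<times> 'n) \<Rightarrow> real
     \<Rightarrow> complex ^ (2 \<times> 'n) ^ (2 \<times> 'n)" where
  "compiled_phase Q C \<phi> =
     tensor_mat (mat 1) (dagger Q) ** dagger C ** tensor_mat (signal_phase \<phi>) (mat 1)
       ** C ** tensor_mat (mat 1) Q"

definition signal_embed :: "'w::finite \<Rightarrow> complex ^ 'w \<Rightarrow> complex ^ (2 \<times> ('w \<times> 'w))" where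
  "signal_embed z v = tensor_vec (ket 0) (tensor_vec v (ket z))"

definition fpaa ::
  "nat \<Rightarrow> (nat \<Rightarrow> real) \<Rightarrow> (nat \<Rightarrow> real) \<Rightarrow> real ^ 'w \<Rightarrow> real ^ 'w \<Rightarrow> complex ^ 'w ^ 'w" where
  "fpaa L \<alpha> \<beta> \<pi> \<pi>' = mat_prod ((L - 1) div 2)
     (\<lambda>j. sel_phase (\<beta> j) (sample_proj \<pi>') ** sel_phase (\<alpha> j) (sample_proj \<pi>))"

definition gqsp_fpaa ::
  "nat \<Rightarrow> (nat \<Rightarrow> real) \<Rightarrow> (nat \<Rightarrow> real)
     \<Rightarrow> complex ^ 'n ^ 'n \<Rightarrow> complex ^ (2 \<times> 'n) ^ (2 \<times> 'n)
     \<Rightarrow> complex ^ 'n ^ 'n \<Rightarrow> complex ^ (2 \<times> 'n) ^ (2 \<times> 'n)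
     \<Rightarrow> complex ^ (2 \<times> 'n) ^ (2 \<times> 'n)" where
  "gqsp_fpaa L \<alpha> \<beta> Q C Q' C' = mat_prod ((L - 1) div 2)
     (\<lambda>j. compiled_phase Q' C' (\<beta> j) ** compiled_phase Q C (\<alpha> j))"

end

theory Submission
  imports Defs "HOL-Computational_Algebra.Fundamental_Theorem_Algebra"
begin

text \<open>
  On \<open>|0\<rangle>|v\<rangle>|0\<rangle>\<close> a compiled phase differs from the ideal one by
  \<open>(cis \<phi> - 1) O\<^sup>\<dagger> C\<^sup>\<dagger> |0\<rangle> \<Upsilon>(W) T r\<close>, where \<open>r\<close> is the part of \<open>v\<close> orthogonal to \<open>|\<pi>\<rangle>\<close>: the GQSP
  unitary fixes \<open>|0\<rangle> T|\<pi>\<rangle>\<close> because \<open>\<Upsilon>(1) = 1\<close> leaves no norm for the \<open>|1\<rangle>\<close> branch.  The vector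
  \<open>T r\<close> is orthogonal to \<open>ker (W - 1)\<close>: if \<open>W f = f\<close> then \<open>T g\<close> with \<open>g = T\<^sup>\<dagger> f\<close> is swap invariant, so
  by detailed balance \<open>g / sqrt \<pi>\<close> is constant along the edges of the irreducible chain and \<open>g\<close> is a
  multiple of \<open>|\<pi>\<rangle>\<close>.  Hence \<open>\<Upsilon>(W)\<close> shrinks \<open>T r\<close> by \<open>\<eta>\<close> and every factor costs at most \<open>2 \<eta>\<close>; the
  errors of the \<open>L - 1\<close> isometric factors add up.  The trace distance of unit vectors \<open>u, v\<close> is the
  norm of the component of \<open>u\<close> orthogonal to \<open>v\<close>, so it changes by at most the norm of a
  perturbation of \<open>u\<close>.
\<close>

section \<open>Matrices and inner products\<close>

lemma braket_add_right: "braket u (v + w) = braket u v + braket u w"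
  by (simp add: braket_def algebra_simps sum.distrib)

lemma braket_diff_right: "braket u (v - w) = braket u v - braket u w"
  by (simp add: braket_def algebra_simps sum_subtractf)

lemma braket_add_left: "braket (u + v) w = braket u w + braket v w"
  by (simp add: braket_def algebra_simps sum.distrib)

lemma braket_diff_left: "braket (u - v) w = braket u w - braket v w"
  by (simp add: braket_def algebra_simps sum_subtractf)

lemma braket_scale_right: "braket u (c *s v) = c * braket u v"
  by (simp add: braket_def sum_distrib_left mult_ac)

lemma braket_scale_left: "braket (c *s u) v = cnj c * braket u v"
  by (simp add: braket_def sum_distrib_left mult_ac)

lemma braket_zero [simp]: "braket u 0 = 0" "braket 0 u = 0"
  by (simp_all add: braket_def)

lemmas braket_simps = braket_add_right braket_diff_right braket_add_left braket_diff_left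
  braket_scale_right braket_scale_left

lemma cnj_braket: "cnj (braket u v) = braket v u"
  by (simp add: braket_def mult.commute)

lemma braket_self: "braket u u = complex_of_real ((norm u)\<^sup>2)"
  by (simp add: braket_def norm_vec_def L2_set_def sum_nonneg complex_norm_square mult.commute
      del: of_real_power)

lemma braket_self_eq: "braket u u = braket v v \<Longrightarrow> norm u = norm v"
  unfolding braket_self of_real_eq_iff by simp

lemma norm_scale: "norm (c *s (v :: complex ^ 'n)) = cmod c * norm v"
  by (simp add: norm_vec_def L2_set_def norm_mult power_mult_distrib real_sqrt_mult
      flip: sum_distrib_left)

section \<open>Decomposition along a unit vector and the trace distance\<close>

lemma pythagoras:
  assumes "braket f r = 0" "norm f = 1"
  shows "(norm (r + c *s f))\<^sup>2 = (norm r)\<^sup>2 + (cmod c)\<^sup>2"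
proof -
  have "braket r f = 0"
    using assms(1) cnj_braket[of f r] by simp
  then have "braket (r + c *s f) (r + c *s f) = braket r r + c * cnj c"
    using assms braket_self[of f] by (simp add: braket_simps mult_ac)
  then show ?thesis
    unfolding braket_self complex_norm_square[symmetric] of_real_add[symmetric] of_real_eq_iff .
qed

lemma orthogonal_remainder:
  assumes "norm f = 1"
  shows "braket f (u - braket f u *s f) = 0"
  using assms by (simp add: braket_simps braket_self)

lemma norm_remainder:
  assumes "norm f = 1"
  shows "(norm (u - braket f u *s f))\<^sup>2 = (norm u)\<^sup>2 - (cmod (braket f u))\<^sup>2"
  using pythagoras[OF orthogonal_remainder[OF assms] assms, of u "braket f u"] by simp

lemma norm_remainder_le:
  assumes "norm f = 1"
  shows "norm (u - braket f u *s f) \<le> norm u"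
  using norm_remainder[OF assms, of u] by (simp add: power2_le_imp_le)

text \<open>By Pythagoras, \<open>1 - |<v|u>|^2\<close> is the squared norm of the part of
  \<open>u\<close> orthogonal to \<open>v\<close>. In this form the trace distance is open to the
  triangle inequality.\<close>

lemma trace_dist_eq_norm_remainder:
  assumes "norm u = 1" "norm v = 1"
  shows "trace_dist u v = norm (u - braket v u *s v)"
proof -
  have "cmod (braket u v) = cmod (braket v u)"
    by (metis cnj_braket complex_mod_cnj)
  then show ?thesis
    unfolding trace_dist_def using norm_remainder[OF assms(2), of u] assms(1)
    by (metis norm_ge_zero one_power2 real_sqrt_unique)
qed

text \<open>Removing the component along \<open>c\<close> is linear and does not increase norms, so
  the remainder of \<open>a\<close> is that of \<open>a - b\<close> plus that of
  \<open>b\<close>.\<close>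

lemma trace_dist_perturb:
  assumes "norm a = 1" "norm b = 1" "norm c = 1"
  shows "trace_dist a c \<le> norm (a - b) + trace_dist b c"
proof -
  have "a - braket c a *s c = ((a - b) - braket c (a - b) *s c) + (b - braket c b *s c)"
    by (simp add: braket_simps vector_sub_rdistrib)
  then have "norm (a - braket c a *s c) \<le> norm (a - b) + norm (b - braket c b *s c)"
    using norm_remainder_le[OF assms(3), of "a - b"]
    by (metis add_mono_thms_linordered_semiring(3) norm_triangle_le)
  then show ?thesis
    using assms by (simp add: trace_dist_eq_norm_remainder)
qed

section \<open>Adjoints, isometries and selective phases\<close>

lemma matrix_vector_mult_scale: "(A :: complex ^ 'n ^ 'm) *v (c *s v) = c *s (A *v v)"
  by (simp add: vec_eq_iff matrix_vector_mult_def sum_distrib_left mult_ac)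

lemma smult_mat_mult_vec: "smult_mat c A *v v = c *s (A *v v)"
  by (simp add: smult_mat_def matrix_vector_mult_def vec_eq_iff sum_distrib_left mult_ac)

lemma matrix_eqI: "(\<And>v. A *v v = B *v v) \<Longrightarrow> (A :: complex ^ 'n ^ 'm) = B"
  by (simp add: matrix_eq)

lemma adjoint_dagger: "braket (A *v x) y = braket x (dagger A *v y)"
  unfolding braket_def matrix_vector_mult_def dagger_def
  by (simp add: sum_distrib_left sum_distrib_right mult_ac, subst sum.swap, simp)

lemma dagger_dagger [simp]: "dagger (dagger A) = A"
  by (simp add: dagger_def vec_eq_iff)

lemma adjoint_dagger': "braket (dagger A *v x) y = braket x (A *v y)"
  by (simp add: adjoint_dagger)

lemma dagger_cancel:
  assumes "dagger U ** U = mat 1"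
  shows "dagger U *v (U *v v) = v"
  by (simp add: assms matrix_vector_mul_assoc)

lemma norm_isometry:
  assumes "dagger U ** U = mat 1"
  shows "norm (U *v v) = norm v"
  by (rule braket_self_eq) (simp add: adjoint_dagger dagger_cancel[OF assms])

lemma ketbra_mult_vec: "ketbra u v *v w = braket v w *s u"
  by (simp add: ketbra_def braket_def matrix_vector_mult_def vec_eq_iff sum_distrib_left
      sum_distrib_right mult_ac)

lemma sel_phase_mult_vec: "sel_phase \<phi> A *v v = v + (cis \<phi> - 1) *s (A *v v)"
  by (simp add: sel_phase_def matrix_vector_mult_add_rdistrib smult_mat_mult_vec)

text \<open>Only the component along \<open>f\<close> is multiplied, by a number of modulus 1; the
  orthogonal part \<open>r\<close> stays as it is.\<close>

lemma norm_sel_phase: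
  assumes "norm f = 1"
  shows "norm (sel_phase \<phi> (ketbra f f) *v v) = norm v"
proof -
  define r where "r = v - braket f v *s f"
  have "v = r + braket f v *s f" "sel_phase \<phi> (ketbra f f) *v v = r + (cis \<phi> * braket f v) *s f"
    by (simp_all add: r_def sel_phase_mult_vec ketbra_mult_vec vector_sub_rdistrib algebra_simps)
  moreover have "braket f r = 0"
    unfolding r_def by (rule orthogonal_remainder[OF assms])
  ultimately have "(norm (sel_phase \<phi> (ketbra f f) *v v))\<^sup>2 = (norm v)\<^sup>2"
    using pythagoras[OF _ assms] by (metis mult_1 norm_cis norm_mult)
  then show ?thesis by simp
qed

section \<open>Polynomials of isometries\<close>

lemma mat_pow_Suc: "mat_pow A (Suc k) = A ** mat_pow A k"
  by (simp add: mat_pow_def)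

lemma mat_pow_0 [simp]: "mat_pow A 0 = mat 1"
  by (simp add: mat_pow_def)

lemma sum_mult_vec: "finite I \<Longrightarrow> (\<Sum>i\<in>I. A i) *v v = (\<Sum>i\<in>I. (A i :: complex ^ 'n ^ 'm) *v v)"
  by (induction I rule: finite_induct) (simp_all add: matrix_vector_mult_add_rdistrib)

text \<open>The bound \<open>n\<close> may exceed the degree, so that polynomials of different
  degrees can be expanded over a common range.\<close>

lemma poly_mat_mult_vec:
  assumes "degree p \<le> n"
  shows "poly_mat p A *v v = (\<Sum>k\<le>n. coeff p k *s (mat_pow A k *v v))"
proof -
  have "poly_mat p A *v v = (\<Sum>k\<le>degree p. coeff p k *s (mat_pow A k *v v))"
    by (simp add: poly_mat_def sum_mult_vec smult_mat_mult_vec)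
  also have "\<dots> = (\<Sum>k\<le>n. coeff p k *s (mat_pow A k *v v))"
    using assms by (intro sum.mono_neutral_left) (auto simp: coeff_eq_0)
  finally show ?thesis .
qed

lemma poly_mat_0 [simp]: "poly_mat 0 A *v v = 0"
  by (simp add: poly_mat_mult_vec[of 0 0])

lemma mult_vec_sum: "finite I \<Longrightarrow> A *v (\<Sum>i\<in>I. f i) = (\<Sum>i\<in>I. (A :: complex ^ 'n ^ 'm) *v f i)"
  by (induction I rule: finite_induct) (simp_all add: matrix_vector_right_distrib)

text \<open>The Horner step, which lets the algebra of \<open>poly_mat\<close> be proved by
  induction over \<open>pCons\<close>.\<close>

lemma poly_mat_pCons: "poly_mat (pCons a p) A *v v = a *s v + A *v (poly_mat p A *v v)"
proof -
  have "poly_mat (pCons a p) A *v v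
      = (\<Sum>k\<le>Suc (degree p). coeff (pCons a p) k *s (mat_pow A k *v v))"
    by (rule poly_mat_mult_vec) (simp add: degree_pCons_le)
  also have "\<dots> = a *s v + (\<Sum>k\<le>degree p. coeff p k *s (A *v (mat_pow A k *v v)))"
    by (simp add: sum.atMost_Suc_shift mat_pow_Suc matrix_vector_mul_assoc del: sum.atMost_Suc)
  also have "\<dots> = a *s v + A *v (poly_mat p A *v v)"
    by (simp add: poly_mat_mult_vec[OF order_refl] mult_vec_sum matrix_vector_mult_scale)
  finally show ?thesis .
qed

lemma poly_mat_add: "poly_mat (p + q) A *v v = poly_mat p A *v v + poly_mat q A *v v"
  using poly_mat_mult_vec[of "p + q" "max (degree p) (degree q)" A v]
    poly_mat_mult_vec[of p "max (degree p) (degree q)" A v]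
    poly_mat_mult_vec[of q "max (degree p) (degree q)" A v]
  by (simp add: degree_add_le vector_sadd_rdistrib sum.distrib)

lemma poly_mat_smult: "poly_mat (smult c p) A *v v = c *s (poly_mat p A *v v)"
  using poly_mat_mult_vec[of "smult c p" "degree p" A v] poly_mat_mult_vec[of p "degree p" A v]
  by (simp add: vec.scale_sum_right degree_smult_le)

lemma poly_mat_mult: "poly_mat (p * q) A *v v = poly_mat p A *v (poly_mat q A *v v)"
  by (induction p) (simp_all add: poly_mat_pCons poly_mat_add poly_mat_smult)

lemma poly_mat_commute: "poly_mat p A *v (A *v v) = A *v (poly_mat p A *v v)"
  by (induction p) (simp_all add: poly_mat_pCons matrix_vector_right_distrib matrix_vector_mult_scale)

lemma poly_mat_eigenvector:
  assumes "A *v v = c *s v"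
  shows "poly_mat p A *v v = poly p c *s v"
  by (induction p)
    (simp_all add: poly_mat_pCons matrix_vector_mult_scale assms vector_sadd_rdistrib mult_ac)

section \<open>Eigenvectors in invariant subspaces\<close>

text \<open>The family is indexed because repetitions may occur: a repeated vector gives a relation
  with coefficients 1 and -1, and otherwise the image has more elements than the dimension.\<close>

lemma nontrivial_relation:
  fixes f :: "nat \<Rightarrow> 'a::euclidean_space"
  shows "\<exists>c. (\<exists>k\<le>DIM('a). c k \<noteq> 0) \<and> (\<Sum>k\<le>DIM('a). c k *\<^sub>R f k) = 0"
proof (cases "inj_on f {..DIM('a)}")
  case True
  then have "dependent (f ` {..DIM('a)})"
    by (intro dependent_biggerset) (simp_all add: card_image)
  then obtain u v where "v \<in> f ` {..DIM('a)}" "u v \<noteq> 0" "(\<Sum>v\<in>f ` {..DIM('a)}. u v *\<^sub>R v) = 0"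
    by (auto simp: dependent_finite)
  then show ?thesis
    by (intro exI[of _ "u \<circ> f"]) (auto simp: sum.reindex[OF True])
next
  case False
  then obtain i j where ij: "i \<le> DIM('a)" "j \<le> DIM('a)" "i \<noteq> j" "f i = f j"
    by (auto simp: inj_on_def)
  define c where "c k = (if k = i then 1 else if k = j then - 1 else 0 :: real)" for k
  have "(\<Sum>k\<le>DIM('a). c k *\<^sub>R f k) = (\<Sum>k\<in>{i,j}. c k *\<^sub>R f k)"
    using ij by (intro sum.mono_neutral_right) (auto simp: c_def)
  also have "\<dots> = 0" using ij by (simp add: c_def)
  finally show ?thesis using ij by (intro exI[of _ c]) (auto simp: c_def)
qed

lemma scaleR_eq_scale: "c *\<^sub>R v = complex_of_real c *s (v :: complex ^ 'n)"
  by (simp add: vec_eq_iff scaleR_conv_of_real[where 'a = complex])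

text \<open>The vectors \<open>A^k v\<close> with \<open>k\<close> up to the real dimension satisfy
  a nontrivial relation with real coefficients, and these are the coefficients of
  \<open>p\<close>.\<close>

lemma annihilating_poly: "\<exists>p. p \<noteq> 0 \<and> poly_mat p A *v (v :: complex ^ 'n) = 0"
proof -
  let ?n = "DIM(complex ^ 'n)"
  obtain c k where c: "k \<le> ?n" "c k \<noteq> 0" "(\<Sum>k\<le>?n. c k *\<^sub>R (mat_pow A k *v v)) = 0"
    using nontrivial_relation[of "\<lambda>k. mat_pow A k *v v"] by blast
  define p where "p = (\<Sum>k\<le>?n. monom (complex_of_real (c k)) k)"
  have coeff: "coeff p i = (if i \<le> ?n then complex_of_real (c i) else 0)" for i
    by (simp add: p_def coeff_sum)
  then have "degree p \<le> ?n"
    by (intro degree_le) auto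
  then have "poly_mat p A *v v = (\<Sum>k\<le>?n. coeff p k *s (mat_pow A k *v v))"
    by (rule poly_mat_mult_vec)
  also have "\<dots> = (\<Sum>k\<le>?n. c k *\<^sub>R (mat_pow A k *v v))"
    by (intro sum.cong) (simp_all add: coeff scaleR_eq_scale)
  also note c(3)
  finally have "poly_mat p A *v v = 0" .
  moreover have "p \<noteq> 0"
    using coeff[of k] c by auto
  ultimately show ?thesis by blast
qed

text \<open>On this type \<open>subspace\<close> asks for real scalars only, while the polynomials
  and eigenvalues here are complex.\<close>

definition csubspace :: "(complex ^ 'n) set \<Rightarrow> bool" where
  "csubspace E \<longleftrightarrow> 0 \<in> E \<and> (\<forall>u\<in>E. \<forall>v\<in>E. u + v \<in> E) \<and> (\<forall>c. \<forall>u\<in>E. c *s u \<in> E)"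

lemma poly_mat_in_invariant_subspace:
  assumes "csubspace E" "\<And>u. u \<in> E \<Longrightarrow> A *v u \<in> E" "v \<in> E"
  shows "poly_mat p A *v v \<in> E"
  using assms by (induction p) (auto simp: poly_mat_pCons csubspace_def)

text \<open>Split a root \<open>c\<close> off a polynomial annihilating \<open>v\<close>. Either the
  quotient \<open>q\<close> still annihilates \<open>v\<close> and has smaller degree, or it sends
  \<open>v\<close> to an eigenvector for \<open>c\<close>, which lies in \<open>E\<close> by
  invariance.\<close>

lemma eigenvector_in_invariant_subspace:
  assumes E: "csubspace E" "\<And>u. u \<in> E \<Longrightarrow> A *v u \<in> E" and v: "v \<in> E" "v \<noteq> 0"
  shows "\<exists>c. \<exists>u\<in>E. u \<noteq> 0 \<and> A *v u = c *s u"
proof -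
  have "\<exists>c. \<exists>u\<in>E. u \<noteq> 0 \<and> A *v u = c *s u" if "p \<noteq> 0" "poly_mat p A *v v = 0" for p
    using that
  proof (induction "degree p" arbitrary: p rule: less_induct)
    case less
    show ?case
    proof (cases "degree p = 0")
      \<comment> \<open>A nonzero constant cannot annihilate the nonzero vector \<open>v\<close>, so
        this case is contradictory.\<close>
      case True
      then obtain a where "p = [:a:]" by (rule degree_eq_zeroE)
      then show ?thesis
        using less.prems v by (simp add: poly_mat_pCons)
    next
      case False
      then have "\<not> constant (poly p)" by (simp add: constant_degree)
      then obtain c where "poly p c = 0"
        using fundamental_theorem_of_algebra by blast
      then obtain q where q: "p = [:- c, 1:] * q"
        by (auto simp: poly_eq_0_iff_dvd)
      define u where "u = poly_mat q A *v v"
      show ?thesis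
      proof (cases "u = 0")
        case True
        have "q \<noteq> 0" using q less.prems by auto
        then have "degree q < degree p" unfolding q by (subst degree_mult_eq) auto
        then show ?thesis
          using less.hyps[of q] \<open>q \<noteq> 0\<close> True by (simp add: u_def)
      next
        case False
        have "(- c) *s u + A *v u = 0"
          using less.prems(2) unfolding q poly_mat_mult by (simp add: poly_mat_pCons u_def)
        then have "A *v u = c *s u"
          by (simp add: add_eq_0_iff vec.scale_minus_left)
        moreover have "u \<in> E"
          unfolding u_def by (rule poly_mat_in_invariant_subspace[OF E v(1)])
        ultimately show ?thesis using False by blast
      qed
    qed
  qed
  then show ?thesis
    using annihilating_poly[of A v] by blast
qed

section \<open>Bounding a polynomial of an isometry by its values on the spectrum\<close>

lemma subspace_csubspace: "csubspace E \<Longrightarrow> subspace E"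
  by (auto simp: csubspace_def subspace_def scaleR_eq_scale)

lemma norm_sq_add_diff:
  "(norm (u + v))\<^sup>2 + (norm (u - v))\<^sup>2 = 2 * (norm u)\<^sup>2 + 2 * (norm (v :: 'a::real_inner))\<^sup>2"
  by (simp add: power2_norm_eq_inner inner_add inner_diff inner_commute)

text \<open>
  The subspace of the next lemma is invariant under everything isometric that commutes with \<open>B\<close>, so
  it contains an eigenvector of \<open>W\<close> when \<open>B\<close> is a polynomial in \<open>W\<close>; this bounds \<open>B\<close> by its
  eigenvalues without the spectral theorem.  Closure under addition is the parallelogram law.
\<close>

lemma norm_attaining_csubspace:
  fixes B :: "complex ^ 'n ^ 'm"
  assumes K: "csubspace K" and bound: "\<And>u. u \<in> K \<Longrightarrow> norm (B *v u) \<le> M * norm u" and "0 \<le> M"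
  shows "csubspace {u \<in> K. norm (B *v u) = M * norm u}"
proof -
  have "norm (B *v (u + v)) = M * norm (u + v)"
    if u: "u \<in> K" "norm (B *v u) = M * norm u" and v: "v \<in> K" "norm (B *v v) = M * norm v" for u v
  proof -
    have "u - v = u + (- 1) *s v"
      by (simp add: vec_eq_iff)
    then have uv: "u + v \<in> K" "u - v \<in> K"
      using K u v by (simp_all only: csubspace_def)
    have "(norm (B *v (u + v)))\<^sup>2 + (norm (B *v (u - v)))\<^sup>2
        = 2 * (norm (B *v u))\<^sup>2 + 2 * (norm (B *v v))\<^sup>2"
      by (simp add: matrix_vector_right_distrib matrix_vector_mult_diff_distrib norm_sq_add_diff)
    also have "\<dots> = M\<^sup>2 * (2 * (norm u)\<^sup>2 + 2 * (norm v)\<^sup>2)"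
      using u v by (simp add: power_mult_distrib algebra_simps)
    also have "\<dots> = (M * norm (u + v))\<^sup>2 + (M * norm (u - v))\<^sup>2"
      unfolding power_mult_distrib norm_sq_add_diff[symmetric] by (simp add: distrib_left)
    finally have "(norm (B *v (u + v)))\<^sup>2 + (norm (B *v (u - v)))\<^sup>2
        = (M * norm (u + v))\<^sup>2 + (M * norm (u - v))\<^sup>2" .
    moreover have "(norm (B *v (u - v)))\<^sup>2 \<le> (M * norm (u - v))\<^sup>2"
      using bound[OF uv(2)] by (intro power_mono) auto
    ultimately have "(M * norm (u + v))\<^sup>2 \<le> (norm (B *v (u + v)))\<^sup>2"
      by linarith
    then have "M * norm (u + v) \<le> norm (B *v (u + v))"
      by (rule power2_le_imp_le) simp
    then show ?thesis
      using bound[OF uv(1)] by linarith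
  qed
  then show ?thesis
    using K by (auto simp: csubspace_def matrix_vector_mult_scale norm_scale mult_ac)
qed

text \<open>Let \<open>M\<close> be the maximum of the norm of \<open>p(W) u\<close> over unit
  vectors \<open>u\<close> orthogonal to all fixed vectors. The vectors attaining the ratio
  \<open>M\<close> form an invariant subspace, so one of them is an eigenvector of \<open>W\<close>.
  Its eigenvalue lies on the unit circle and is not 1, hence \<open>M\<close> is at most
  \<open>\<eta>\<close>.\<close>

lemma isometry_poly_bound:
  fixes W :: "complex ^ 'n ^ 'n"
  assumes iso: "dagger W ** W = mat 1"
    and bound: "\<And>\<theta>. eigenvalue_of W (cis \<theta>) \<Longrightarrow> cis \<theta> \<noteq> 1 \<Longrightarrow> cmod (poly p (cis \<theta>)) \<le> \<eta>"
    and perp: "\<And>f. W *v f = f \<Longrightarrow> braket f r = 0"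
  shows "norm (poly_mat p W *v r) \<le> \<eta> * norm r"
proof (cases "r = 0")
  case False
  define K where "K = {u. \<forall>f. W *v f = f \<longrightarrow> braket f u = 0}"
  have K: "csubspace K"
    by (auto simp: K_def csubspace_def braket_simps)
  have r: "r \<in> K"
    using perp by (simp add: K_def)
  have KW: "W *v u \<in> K" if "u \<in> K" for u
  proof -
    \<comment> \<open>For a fixed \<open>f\<close>, the isometry gives
      \<open><f|W u> = <W f|W u> = <f|u>\<close>.\<close>
    have "braket f (W *v u) = braket f u" if "W *v f = f" for f
      using adjoint_dagger[of W f "W *v u"] dagger_cancel[OF iso] that by simp
    with that show ?thesis by (simp add: K_def)
  qed
  have unit: "inverse (norm u) *\<^sub>R u \<in> K \<inter> sphere 0 1" if "u \<in> K" "u \<noteq> 0" for u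
    using that subspace_csubspace[OF K] by (simp add: subspace_scale)
  have "compact (K \<inter> sphere 0 1)"
    using subspace_csubspace[OF K] by (intro closed_Int_compact closed_subspace) auto
  moreover have "K \<inter> sphere 0 1 \<noteq> {}"
    using unit[OF r False] by blast
  moreover have "continuous_on (K \<inter> sphere 0 1) (\<lambda>u. norm (poly_mat p W *v u))"
    by (intro continuous_on_norm linear_continuous_on matrix_vector_mul_bounded_linear)
  ultimately obtain u0 where u0: "u0 \<in> K" "norm u0 = 1"
    and max: "\<And>u. u \<in> K \<Longrightarrow> norm u = 1 \<Longrightarrow> norm (poly_mat p W *v u) \<le> norm (poly_mat p W *v u0)"
    using continuous_attains_sup by (metis (no_types, lifting) IntD1 IntD2 IntI mem_sphere_0)
  define M where "M = norm (poly_mat p W *v u0)"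
  have M: "norm (poly_mat p W *v u) \<le> M * norm u" if "u \<in> K" for u
  proof (cases "u = 0")
    case False
    then have "norm (poly_mat p W *v (inverse (norm u) *\<^sub>R u)) \<le> M"
      unfolding M_def using unit[OF that False] by (intro max) auto
    then show ?thesis
      using False by (simp add: scaleR_eq_scale matrix_vector_mult_scale norm_scale norm_divide
          field_simps)
  qed simp
  define E where "E = {u \<in> K. norm (poly_mat p W *v u) = M * norm u}"
  have E: "csubspace E"
    unfolding E_def using K M by (rule norm_attaining_csubspace) (auto simp: M_def)
  \<comment> \<open>\<open>W\<close> commutes with \<open>p(W)\<close> and preserves norms, so both
    sides of the equation defining \<open>E\<close> are unchanged.\<close>
  have EW: "W *v u \<in> E" if "u \<in> E" for u
    using that KW by (simp add: E_def poly_mat_commute norm_isometry[OF iso])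
  have "u0 \<in> E" "u0 \<noteq> 0"
    using u0 by (auto simp: E_def M_def)
  then obtain c u where u: "u \<in> E" "u \<noteq> 0" "W *v u = c *s u"
    using eigenvector_in_invariant_subspace[OF E EW] by blast
  have "cmod c = 1"
    using norm_isometry[OF iso, of u] u by (simp add: norm_scale)
  then obtain \<theta> where \<theta>: "c = cis \<theta>"
    by (metis mult_1 of_real_1 rcis_cmod_Arg rcis_def)
  \<comment> \<open>Otherwise \<open>u\<close> would be a fixed vector orthogonal to all fixed
    vectors, hence to itself.\<close>
  have "c \<noteq> 1"
  proof
    assume "c = 1"
    then have "braket u u = 0"
      using u by (simp add: E_def K_def)
    then show False
      using u by (simp add: braket_self)
  qed
  moreover have "eigenvalue_of W c"
    using u by (auto simp: eigenvalue_of_def)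
  ultimately have "cmod (poly p c) \<le> \<eta>"
    using bound[of \<theta>] \<theta> by simp
  moreover have "M * norm u = cmod (poly p c) * norm u"
    using u by (simp add: E_def poly_mat_eigenvector norm_scale)
  ultimately have "M \<le> \<eta>"
    using u by simp
  then show ?thesis
    using M[OF r] by (meson mult_right_mono norm_ge_zero order_trans)
qed simp

section \<open>The Szegedy walk\<close>

lemma ket_nth: "ket i $ j = (if j = i then 1 else 0)"
  by (simp add: ket_def axis_def)

lemma sum_mult_ket: "(\<Sum>y\<in>UNIV. f y * ket y $ i) = f i"
  by (simp add: ket_nth if_distrib cong: if_cong)

lemma szegedy_T_entry:
  "szegedy_T P $ p $ x = (if fst p = x then complex_of_real (sqrt (P $ x $ snd p)) else 0)"
  by (simp add: szegedy_T_def tensor_vec_def ket_nth if_distrib cong: if_cong)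

lemma szegedy_T_mult_vec:
  "(szegedy_T P *v v) $ p = complex_of_real (sqrt (P $ fst p $ snd p)) * v $ fst p"
  by (simp add: matrix_vector_mult_def szegedy_T_entry if_distrib if_distribR cong: if_cong)

lemma swap_op_mult_vec: "(swap_op *v u) $ p = u $ (snd p, fst p)"
proof -
  have "(swap_op *v u) $ p = (\<Sum>q\<in>UNIV. (if q = (snd p, fst p) then 1 else 0) * u $ q)"
    unfolding matrix_vector_mult_def
    by (auto simp: swap_op_def tensor_vec_def ket_nth intro!: sum.cong)
  also have "\<dots> = u $ (snd p, fst p)"
    by (simp add: if_distrib if_distribR cong: if_cong)
  finally show ?thesis .
qed

lemma swap_op_swap_op: "swap_op *v (swap_op *v u) = u"
  by (simp add: vec_eq_iff swap_op_mult_vec)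

lemma dagger_szegedy_T_mult_vec:
  "(dagger (szegedy_T P) *v u) $ x = (\<Sum>y\<in>UNIV. complex_of_real (sqrt (P $ x $ y)) * u $ (x, y))"
proof -
  have "(dagger (szegedy_T P) *v u) $ x
      = (\<Sum>p\<in>UNIV. (if fst p = x then complex_of_real (sqrt (P $ x $ snd p)) else 0) * u $ p)"
    unfolding matrix_vector_mult_def dagger_def
    by (auto simp: szegedy_T_entry intro!: sum.cong)
  also have "\<dots> = (\<Sum>a\<in>UNIV. \<Sum>b\<in>UNIV.
      (if a = x then complex_of_real (sqrt (P $ x $ b)) else 0) * u $ (a, b))"
    unfolding sum.cartesian_product UNIV_Times_UNIV by (auto intro!: sum.cong)
  also have "\<dots> = (\<Sum>a\<in>UNIV. if a = x then
      (\<Sum>b\<in>UNIV. complex_of_real (sqrt (P $ x $ b)) * u $ (x, b)) else 0)"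
    by (intro sum.cong refl) simp
  finally show ?thesis by simp
qed

text \<open>Column \<open>x\<close> of \<open>T\<close> is supported on pairs beginning with
  \<open>x\<close>, and its squared amplitudes are row \<open>x\<close> of \<open>P\<close>, which
  sums to 1.\<close>

lemma dagger_szegedy_T_szegedy_T:
  assumes "stochastic P"
  shows "dagger (szegedy_T P) ** szegedy_T P = mat 1"
proof (rule matrix_eqI)
  fix v :: "complex ^ 'a"
  have "(\<Sum>y\<in>UNIV. complex_of_real (sqrt (P $ x $ y)) * (complex_of_real (sqrt (P $ x $ y)) * v $ x))
      = v $ x" for x
  proof -
    have "(\<Sum>y\<in>UNIV. complex_of_real (sqrt (P $ x $ y)) * (complex_of_real (sqrt (P $ x $ y)) * v $ x))
        = complex_of_real (\<Sum>y\<in>UNIV. P $ x $ y) * v $ x"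
      using assms
      by (simp add: stochastic_def mult.assoc[symmetric] del: of_real_sum
          flip: of_real_mult sum_distrib_right of_real_sum)
    also have "(\<Sum>y\<in>UNIV. P $ x $ y) = 1"
      using assms by (simp add: stochastic_def)
    finally show ?thesis by simp
  qed
  then show "(dagger (szegedy_T P) ** szegedy_T P) *v v = mat 1 *v v"
    by (simp add: vec_eq_iff dagger_szegedy_T_mult_vec szegedy_T_mult_vec
        flip: matrix_vector_mul_assoc)
qed

section \<open>Isometry and fixed vectors of the walk\<close>

lemma szegedy_walk_mult_vec:
  "szegedy_walk P *v u
     = 2 *s (szegedy_T P *v (dagger (szegedy_T P) *v (swap_op *v u))) - swap_op *v u"
  by (simp add: szegedy_walk_def smult_mat_mult_vec matrix_vector_mult_diff_rdistrib
      flip: matrix_vector_mul_assoc)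

lemma braket_swap_op: "braket (swap_op *v u) (swap_op *v v) = braket u v"
proof -
  have "bij (\<lambda>p :: 'a \<times> 'a. (snd p, fst p))"
    by (rule involuntory_imp_bij) simp
  then show ?thesis
    unfolding braket_def swap_op_mult_vec
    by (rule sum.reindex_bij_betw)
qed

text \<open>The difference \<open>A\<^sup>\<dagger> A v - v\<close> is orthogonal to every vector,
  in particular to itself.\<close>

lemma isometryI:
  assumes "\<And>u v. braket (A *v u) (A *v v) = braket u v"
  shows "dagger A ** A = mat 1"
proof (rule matrix_eqI)
  fix v
  have "braket w ((dagger A ** A) *v v - v) = 0" for w
    using assms[of w v]
    by (simp add: braket_simps adjoint_dagger flip: matrix_vector_mul_assoc)
  from this[of "(dagger A ** A) *v v - v"] show "(dagger A ** A) *v v = mat 1 *v v"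
    by (simp add: braket_self)
qed

text \<open>The walk is the swap followed by the reflection
  \<open>2 T T\<^sup>\<dagger> - 1\<close>; both preserve inner products.\<close>

lemma szegedy_walk_isometry:
  assumes "stochastic P"
  shows "dagger (szegedy_walk P) ** szegedy_walk P = mat 1"
proof (rule isometryI)
  fix u v
  let ?T = "szegedy_T P"
  \<comment> \<open>With \<open>x = T\<^sup>\<dagger> a\<close> and
    \<open>y = T\<^sup>\<dagger> b\<close>, each product other than \<open><a|b>\<close> equals
    \<open><x|y>\<close>, and the coefficients 4, -2, -2 cancel.\<close>
  have *: "braket (2 *s (?T *v (dagger ?T *v a)) - a) (2 *s (?T *v (dagger ?T *v b)) - b)
      = braket a b" for a b
  proof -
    define x y where "x = dagger ?T *v a" and "y = dagger ?T *v b"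
    have "braket (?T *v x) (?T *v y) = braket x y" "braket (?T *v x) b = braket x y"
      by (simp_all add: adjoint_dagger y_def dagger_cancel[OF dagger_szegedy_T_szegedy_T[OF assms]])
    moreover have "braket a (?T *v y) = braket x y"
      by (simp add: x_def adjoint_dagger')
    ultimately show ?thesis
      unfolding x_def[symmetric] y_def[symmetric] by (simp add: braket_simps)
  qed
  show "braket (szegedy_walk P *v u) (szegedy_walk P *v v) = braket u v"
    unfolding szegedy_walk_mult_vec * braket_swap_op ..
qed

text \<open>Applying \<open>T\<^sup>\<dagger>\<close> to \<open>W f = f\<close> gives
  \<open>T\<^sup>\<dagger> S f = g\<close>. The equation then reads \<open>f + S f = 2 T g\<close>,
  whose left side is swap invariant.\<close>

lemma szegedy_walk_fixed_vector:
  assumes "stochastic P" and fixed: "szegedy_walk P *v f = f"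
  defines "g \<equiv> dagger (szegedy_T P) *v f"
  shows "swap_op *v (szegedy_T P *v g) = szegedy_T P *v g"
proof -
  let ?T = "szegedy_T P" and ?S = swap_op
  have T: "dagger ?T *v (?T *v v) = v" for v
    by (rule dagger_cancel[OF dagger_szegedy_T_szegedy_T[OF assms(1)]])
  have Sf: "f = 2 *s (?T *v (dagger ?T *v (?S *v f))) - ?S *v f"
    using fixed by (simp add: szegedy_walk_mult_vec)
  from arg_cong[where f = "\<lambda>u. dagger ?T *v u", OF this]
  have "g = 2 *s (dagger ?T *v (?S *v f)) - dagger ?T *v (?S *v f)"
    by (simp add: g_def matrix_vector_mult_diff_distrib matrix_vector_mult_scale T)
  then have "dagger ?T *v (?S *v f) = g"
    by (simp add: vec_eq_iff)
  then have "f + ?S *v f = 2 *s (?T *v g)"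
    using Sf by simp (metis diff_add_cancel)
  moreover from arg_cong[where f = "\<lambda>u. ?S *v u", OF this]
  have "?S *v f + f = 2 *s (?S *v (?T *v g))"
    by (simp add: matrix_vector_right_distrib matrix_vector_mult_scale swap_op_swap_op)
  ultimately have "2 *s (?S *v (?T *v g)) = 2 *s (?T *v g)"
    by (metis add.commute)
  then show ?thesis
    by (simp add: vec_eq_iff)
qed

section \<open>Irreducible reversible chains and the fixed space\<close>

text \<open>Induction along the edges of the chain: a positive probability of going from
  \<open>x\<close> to \<open>y\<close> in \<open>Suc n\<close> steps contains a positive first step.
  It is applied to the support of \<open>\<pi>\<close> and to the level set of a function constant
  along edges.\<close>

lemma irreducible_closed_set:
  assumes P: "stochastic P" "chain_irreducible P"
    and closed: "\<And>x y. x \<in> A \<Longrightarrow> 0 < P $ x $ y \<Longrightarrow> y \<in> A" and "x \<in> A"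
  shows "y \<in> A"
proof -
  have "y \<in> A" if "x \<in> A" "0 < mat_pow P n $ x $ y" for n x y
    using that
  proof (induction n arbitrary: x)
    case 0
    then show ?case by (auto simp: mat_def split: if_splits)
  next
    case (Suc n)
    have "0 < (\<Sum>z\<in>UNIV. P $ x $ z * mat_pow P n $ z $ y)"
      using Suc.prems(2) by (simp add: mat_pow_Suc matrix_matrix_mult_def)
    then obtain z where z: "0 < P $ x $ z * mat_pow P n $ z $ y"
      by (meson not_less sum_nonpos)
    moreover have "0 \<le> P $ x $ z"
      using P(1) by (simp add: stochastic_def)
    ultimately have "0 < P $ x $ z" "0 < mat_pow P n $ z $ y"
      by (simp_all add: zero_less_mult_iff)
    then show ?case
      using Suc closed by blast
  qed
  then show ?thesis
    using P(2) \<open>x \<in> A\<close> unfolding chain_irreducible_def by blast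
qed

lemma qsample_nth: "qsample \<pi> $ x = complex_of_real (sqrt (\<pi> $ x))"
  by (simp add: qsample_def ket_nth if_distrib cong: if_cong)

lemma norm_qsample:
  assumes "prob_vec \<pi>"
  shows "norm (qsample \<pi>) = 1"
  using assms by (simp add: norm_vec_def L2_set_def qsample_nth prob_vec_def)

text \<open>The support is nonempty since the masses sum to 1, and detailed balance carries
  positivity along each edge.\<close>

lemma stationary_dist_pos:
  assumes P: "stochastic P" "chain_irreducible P" and \<pi>: "prob_vec \<pi>" "reversible_wrt P \<pi>"
  shows "0 < \<pi> $ x"
proof -
  have "\<exists>x0. 0 < \<pi> $ x0"
  proof (rule ccontr)
    assume "\<nexists>x0. 0 < \<pi> $ x0"
    then have "(\<Sum>x\<in>UNIV. \<pi> $ x) \<le> 0"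
      by (intro sum_nonpos) (simp add: not_less)
    then show False
      using \<pi>(1) by (simp add: prob_vec_def)
  qed
  then obtain x0 where "0 < \<pi> $ x0" ..
  moreover have "0 < \<pi> $ y" if "0 < \<pi> $ x" "0 < P $ x $ y" for x y
  proof -
    have "0 < \<pi> $ y * P $ y $ x"
      using \<pi>(2) that by (metis mult_pos_pos reversible_wrt_def)
    then show ?thesis
      using \<pi>(1) by (metis less_eq_real_def mult_zero_left order_less_irrefl prob_vec_def)
  qed
  ultimately show ?thesis
    using irreducible_closed_set[OF P, of "{x. 0 < \<pi> $ x}" x0 x] by auto
qed

lemma sqrt_detailed_balance:
  assumes "reversible_wrt P \<pi>"
  shows "sqrt (\<pi> $ x) * sqrt (P $ x $ y) = sqrt (\<pi> $ y) * sqrt (P $ y $ x)"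
  using assms by (metis real_sqrt_mult reversible_wrt_def)

text \<open>Positivity of \<open>\<pi>\<close> allows the quotient \<open>h\<close> of
  \<open>g\<close> by \<open>sqrt \<pi>\<close>. Swap invariance at the entry \<open>(x, y)\<close>
  makes \<open>h\<close> agree at both ends of an edge, and irreducibility makes it
  constant.\<close>

lemma swap_invariant_szegedy_T:
  assumes P: "stochastic P" "chain_irreducible P" and \<pi>: "prob_vec \<pi>" "reversible_wrt P \<pi>"
    and swap: "swap_op *v (szegedy_T P *v g) = szegedy_T P *v g"
  shows "\<exists>c. g = c *s qsample \<pi>"
proof -
  define h where "h x = g $ x / complex_of_real (sqrt (\<pi> $ x))" for x
  have pos: "0 < \<pi> $ x" for x
    by (rule stationary_dist_pos[OF P \<pi>])
  have gh: "g $ x = h x * complex_of_real (sqrt (\<pi> $ x))" for x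
    using pos[of x] by (simp add: h_def)
  have step: "h x = h y" if "0 < P $ x $ y" for x y
  proof -
    have "complex_of_real (sqrt (P $ y $ x)) * g $ y = complex_of_real (sqrt (P $ x $ y)) * g $ x"
      using swap unfolding vec_eq_iff
      by (auto simp: swap_op_mult_vec szegedy_T_mult_vec dest: spec[of _ "(x, y)"])
    then have "h y * complex_of_real (sqrt (\<pi> $ y) * sqrt (P $ y $ x))
        = h x * complex_of_real (sqrt (\<pi> $ x) * sqrt (P $ x $ y))"
      by (simp add: gh mult_ac)
    \<comment> \<open>Detailed balance makes the two real factors equal, and the common value is
      nonzero because \<open>\<pi> $ x\<close> and \<open>P $ x $ y\<close> are positive.\<close>
    then show ?thesis
      using that pos[of x] unfolding sqrt_detailed_balance[OF \<pi>(2), of x y, symmetric] by simp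
  qed
  obtain x0 :: 'a where True by blast
  have "h x = h x0" for x
    using irreducible_closed_set[OF P, of "{x. h x = h x0}" x0 x] step by auto
  then have "g = h x0 *s qsample \<pi>"
    by (simp add: vec_eq_iff gh qsample_nth)
  then show ?thesis ..
qed

text \<open>Its amplitude at \<open>(x, y)\<close> is \<open>sqrt (\<pi> x * P x y)\<close>,
  symmetric by detailed balance, so the swap fixes the vector; the reflection fixes the range of
  \<open>T\<close>.\<close>

lemma szegedy_walk_fixes_qsample:
  assumes "stochastic P" "reversible_wrt P \<pi>"
  shows "szegedy_walk P *v (szegedy_T P *v qsample \<pi>) = szegedy_T P *v qsample \<pi>"
proof -
  have "swap_op *v (szegedy_T P *v qsample \<pi>) = szegedy_T P *v qsample \<pi>"
    using sqrt_detailed_balance[OF assms(2)]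
    by (simp add: vec_eq_iff swap_op_mult_vec szegedy_T_mult_vec qsample_nth mult.commute
        flip: of_real_mult)
  then show ?thesis
    by (simp add: szegedy_walk_mult_vec dagger_cancel[OF dagger_szegedy_T_szegedy_T[OF assms(1)]])
      (simp add: vec_eq_iff)
qed

text \<open>Moving \<open>T\<close> to the other side leaves \<open>T\<^sup>\<dagger> f\<close>, a
  multiple of \<open>|\<pi>>\<close>, against a vector orthogonal to \<open>|\<pi>>\<close>.\<close>

lemma szegedy_T_remainder_perp_fixed:
  assumes P: "stochastic P" "chain_irreducible P" and \<pi>: "prob_vec \<pi>" "reversible_wrt P \<pi>"
    and "szegedy_walk P *v f = f"
  shows "braket f (szegedy_T P *v (v - braket (qsample \<pi>) v *s qsample \<pi>)) = 0"
proof -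
  obtain c where "dagger (szegedy_T P) *v f = c *s qsample \<pi>"
    using swap_invariant_szegedy_T[OF P \<pi> szegedy_walk_fixed_vector[OF P(1) assms(5)]] by blast
  then show ?thesis
    using orthogonal_remainder[OF norm_qsample[OF \<pi>(1)], of v]
    by (simp add: braket_scale_left flip: adjoint_dagger')
qed

section \<open>Compiled selective phases\<close>

lemma sum_UNIV_prod:
  "(\<Sum>p\<in>UNIV. f p) = (\<Sum>x\<in>UNIV. \<Sum>y\<in>UNIV. f (x :: 'a::finite, y :: 'b::finite))"
  unfolding sum.cartesian_product UNIV_Times_UNIV by simp

lemma braket_tensor_vec: "braket (tensor_vec a b) (tensor_vec c d) = braket a c * braket b d"
  by (simp add: braket_def tensor_vec_def sum_UNIV_prod sum_product mult_ac)

lemma braket_ket_left: "braket (ket i) v = v $ i"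
  by (simp add: braket_def ket_nth if_distrib if_distribR cong: if_cong)

lemma braket_ket: "braket (ket i) (ket j) = (if i = j then 1 else 0)"
  by (simp add: braket_ket_left) (simp add: ket_nth)

lemma norm_tensor_ket: "norm (tensor_vec (ket i) v) = norm v" "norm (tensor_vec v (ket i)) = norm v"
  by (rule braket_self_eq, simp add: braket_tensor_vec braket_ket)+

lemma tensor_vec_add_right: "tensor_vec a (b + c) = tensor_vec a b + tensor_vec a c"
  by (simp add: tensor_vec_def vec_eq_iff algebra_simps)

lemma tensor_vec_scale_right: "tensor_vec a (c *s b) = c *s tensor_vec a b"
  by (simp add: tensor_vec_def vec_eq_iff)

lemma tensor_vec_scale_left: "tensor_vec (c *s a) b = c *s tensor_vec a b"
  by (simp add: tensor_vec_def vec_eq_iff)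

lemma tensor_ket_mat_mult_vec: "tensor_ket_mat u A *v v = tensor_vec u (A *v v)"
  by (simp add: tensor_ket_mat_def tensor_vec_def matrix_vector_mult_def vec_eq_iff
      sum_distrib_left mult_ac)

lemma tensor_mat_mult_vec: "tensor_mat A B *v tensor_vec u v = tensor_vec (A *v u) (B *v v)"
  by (simp add: tensor_mat_def tensor_vec_def matrix_vector_mult_def vec_eq_iff sum_UNIV_prod
      sum_product mult_ac)

lemma tensor_mat_mult: "tensor_mat A B ** tensor_mat C D = tensor_mat (A ** C) (B ** D)"
  by (simp add: tensor_mat_def matrix_matrix_mult_def vec_eq_iff sum_UNIV_prod
      sum_product mult_ac)

lemma dagger_tensor_mat: "dagger (tensor_mat A B) = tensor_mat (dagger A) (dagger B)"
  by (simp add: tensor_mat_def dagger_def vec_eq_iff)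

lemma tensor_mat_one: "tensor_mat (mat 1) (mat 1) = mat 1"
  by (auto simp: tensor_mat_def mat_def vec_eq_iff prod_eq_iff)

lemma tensor_mat_isometry:
  assumes "dagger A ** A = mat 1" "dagger B ** B = mat 1"
  shows "dagger (tensor_mat A B) ** tensor_mat A B = mat 1"
  by (simp add: dagger_tensor_mat tensor_mat_mult assms tensor_mat_one)

lemma dagger_one: "dagger (mat 1) = mat 1"
  by (auto simp: dagger_def mat_def vec_eq_iff)

lemma ketbra_ket_mult_vec: "ketbra (ket i) (ket i) *v v = v $ i *s ket i"
  by (simp add: ketbra_mult_vec braket_ket_left)

section \<open>The signal phase, the oracle and the GQSP block\<close>

lemma signal_phase_mult_vec:
  "(signal_phase \<phi> *v v) $ i = (if i = 0 then cis \<phi> else 1) * v $ i"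
proof -
  have "signal_phase \<phi> *v v = (cis \<phi> * v $ 0) *s ket 0 + v $ 1 *s ket 1"
    by (simp add: signal_phase_def matrix_vector_mult_add_rdistrib smult_mat_mult_vec
        ketbra_ket_mult_vec)
  \<comment> \<open>\<open>exhaust_2\<close> names the two indices \<open>1\<close> and
    \<open>2\<close>, and in the type \<open>2\<close> the latter equals \<open>0\<close>.\<close>
  moreover have "i = 0 \<or> i = 1"
    using exhaust_2[of i] by auto
  ultimately show ?thesis
    by (elim disjE) (simp_all add: ket_nth)
qed

lemma signal_phase_isometry: "dagger (signal_phase \<phi>) ** signal_phase \<phi> = mat 1"
proof (rule isometryI)
  fix u v
  have "cnj (cis \<phi>) * cis \<phi> = 1"
    by (simp add: cis_cnj cis_mult)
  then have "cnj (cis \<phi> * a) * (cis \<phi> * b) = cnj a * b" for a b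
    by (simp add: mult.assoc mult.left_commute) (metis mult.assoc mult.commute mult_1)
  then show "braket (signal_phase \<phi> *v u) (signal_phase \<phi> *v v) = braket u v"
    unfolding braket_def signal_phase_mult_vec by (intro sum.cong) auto
qed

lemma signal_phase_ket:
  "signal_phase \<phi> *v ket 0 = cis \<phi> *s ket 0" "signal_phase \<phi> *v ket 1 = ket 1"
  by (simp_all add: vec_eq_iff signal_phase_mult_vec ket_nth)

lemma norm_compiled_phase:
  assumes "unitary Q" "unitary C"
  shows "norm (compiled_phase Q C \<phi> *v v) = norm v"
proof -
  have "dagger (dagger Q) ** dagger Q = mat 1" "dagger (dagger C) ** dagger C = mat 1"
    "dagger Q ** Q = mat 1" "dagger C ** C = mat 1"
    using assms by (simp_all add: unitary_def)
  then show ?thesis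
    by (simp add: compiled_phase_def norm_isometry tensor_mat_isometry signal_phase_isometry
        dagger_one flip: matrix_vector_mul_assoc)
qed

text \<open>The oracle is specified on basis vectors only, where its values are the columns of
  \<open>T\<close>; linearity extends this to all \<open>v\<close>.\<close>

lemma oracle_mult_vec:
  assumes "is_oracle z P Q"
  shows "Q *v tensor_vec v (ket z) = szegedy_T P *v v"
proof -
  have "(\<Sum>y\<in>UNIV. complex_of_real (sqrt (P $ x $ y)) *s tensor_vec (ket x) (ket y))
      = szegedy_T P *v ket x" for x
    by (simp add: vec_eq_iff szegedy_T_mult_vec tensor_vec_def mult.assoc[symmetric] sum_mult_ket)
      (simp add: ket_nth)
  then have ket: "Q *v tensor_vec (ket x) (ket z) = szegedy_T P *v ket x" for x
    using assms by (simp add: is_oracle_def)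
  have v: "v = (\<Sum>x\<in>UNIV. v $ x *s ket x)"
    by (simp add: vec_eq_iff sum_mult_ket)
  have "tensor_vec v (ket z) = (\<Sum>x\<in>UNIV. v $ x *s tensor_vec (ket x) (ket z))"
    by (simp add: vec_eq_iff tensor_vec_def mult.assoc[symmetric] sum_mult_ket
        flip: sum_distrib_right)
  then have "Q *v tensor_vec v (ket z) = (\<Sum>x\<in>UNIV. v $ x *s (szegedy_T P *v ket x))"
    by (simp add: mult_vec_sum matrix_vector_mult_scale ket)
  also have "\<dots> = szegedy_T P *v v"
    by (subst (2) v) (simp add: mult_vec_sum matrix_vector_mult_scale)
  finally show ?thesis .
qed

text \<open>The \<open>|0>\<close> branch is \<open>Y(1) f = f\<close> and carries the whole norm of
  the input, so the isometry \<open>C\<close> leaves nothing for the \<open>|1>\<close>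
  branch.\<close>

lemma gqsp_fixes_fixed_vector:
  assumes C: "dagger C ** C = mat 1"
    and block: "\<And>w. C *v tensor_vec (ket 0) w
      = tensor_vec (ket 0) (poly_mat Y W *v w) + tensor_vec (ket (1 :: 2)) (poly_mat X W *v w)"
    and "poly Y 1 = 1" and "W *v f = f"
  shows "C *v tensor_vec (ket 0) f = tensor_vec (ket 0) f"
proof -
  let ?b = "tensor_vec (ket (1 :: 2)) (poly_mat X W *v f)"
  have Yf: "poly_mat Y W *v f = f"
    using poly_mat_eigenvector[of W f 1 Y] assms(3,4) by simp
  have "complex_of_real ((norm (C *v tensor_vec (ket 0) f))\<^sup>2)
      = complex_of_real ((norm f)\<^sup>2) + complex_of_real ((norm (poly_mat X W *v f))\<^sup>2)"
    unfolding braket_self[symmetric] block Yf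
    by (simp add: braket_simps braket_tensor_vec braket_ket)
  then have "(norm (C *v tensor_vec (ket 0) f))\<^sup>2 = (norm f)\<^sup>2 + (norm (poly_mat X W *v f))\<^sup>2"
    unfolding of_real_add[symmetric] of_real_eq_iff .
  then have "poly_mat X W *v f = 0"
    by (simp add: norm_isometry[OF C] norm_tensor_ket)
  then show ?thesis
    by (simp add: block Yf) (simp add: tensor_vec_def vec_eq_iff)
qed

text \<open>Split \<open>T v\<close> as \<open>T r + a f\<close> with \<open>f = T|\<pi>>\<close>.
  The \<open>f\<close> part reproduces the ideal phase exactly, and the error is the
  \<open>T r\<close> part, shrunk by \<open>\<eta>\<close> and multiplied by
  \<open>cis \<phi> - 1\<close>.\<close>

lemma compiled_phase_approx:
  assumes P: "stochastic P" "chain_irreducible P" and \<pi>: "prob_vec \<pi>" "reversible_wrt P \<pi>"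
    and Q: "is_oracle z P Q" and C: "is_gqsp (szegedy_walk P) \<eta> C" and "0 \<le> \<eta>"
  shows "norm (compiled_phase Q C \<phi> *v signal_embed z v
      - signal_embed z (sel_phase \<phi> (sample_proj \<pi>) *v v)) \<le> 2 * \<eta> * norm v"
proof -
  let ?W = "szegedy_walk P" and ?T = "szegedy_T P"
  let ?k = "\<lambda>w. tensor_vec (ket (0 :: 2)) w"
  define e where "e = cis \<phi> - 1"
  define a r f where "a = braket (qsample \<pi>) v" and "r = v - a *s qsample \<pi>"
    and "f = ?T *v qsample \<pi>"
  obtain Y X where
    YX: "C ** tensor_ket_mat (ket 0) (mat 1)
        = tensor_ket_mat (ket 0) (poly_mat Y ?W) + tensor_ket_mat (ket 1) (poly_mat X ?W)"
    and Y1: "poly Y 1 = 1"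
    and Y: "\<And>\<theta>. eigenvalue_of ?W (cis \<theta>) \<Longrightarrow> cis \<theta> \<noteq> 1 \<Longrightarrow> cmod (poly Y (cis \<theta>)) \<le> \<eta>"
    using C unfolding is_gqsp_def by blast
  have U: "dagger Q ** Q = mat 1" "dagger C ** C = mat 1"
    "dagger (dagger Q) ** dagger Q = mat 1" "dagger (dagger C) ** dagger C = mat 1"
    using Q C by (simp_all add: is_oracle_def is_gqsp_def unitary_def)
  have block: "C *v ?k w = ?k (poly_mat Y ?W *v w) + tensor_vec (ket 1) (poly_mat X ?W *v w)" for w
    using arg_cong[OF YX, of "\<lambda>M. M *v w"]
    by (simp add: tensor_ket_mat_mult_vec matrix_vector_mult_add_rdistrib
        flip: matrix_vector_mul_assoc)
  have Wf: "?W *v f = f"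
    unfolding f_def by (rule szegedy_walk_fixes_qsample[OF P(1) \<pi>(2)])
  have "C *v ?k f = ?k f"
    by (rule gqsp_fixes_fixed_vector[OF U(2) block Y1 Wf])
  then have Cf: "dagger C *v ?k f = ?k f"
    using dagger_cancel[OF U(2), of "?k f"] by simp
  have Tv: "?T *v v = ?T *v r + a *s f"
    by (simp add: r_def f_def matrix_vector_mult_diff_distrib matrix_vector_mult_scale)
  have "poly_mat Y ?W *v f = f"
    using poly_mat_eigenvector[of ?W f 1 Y] Wf Y1 by simp
  then have YT: "poly_mat Y ?W *v (?T *v v) = a *s f + poly_mat Y ?W *v (?T *v r)"
    by (simp add: Tv matrix_vector_right_distrib matrix_vector_mult_scale)
  have S: "?T *v (sel_phase \<phi> (sample_proj \<pi>) *v v) = ?T *v v + (e * a) *s f"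
    by (simp add: sample_proj_def sel_phase_mult_vec ketbra_mult_vec f_def a_def
        e_def matrix_vector_right_distrib matrix_vector_mult_scale)
  let ?D = "\<lambda>x. tensor_mat (mat 1) (dagger Q) *v x"
  have uncompute: "?D (?k (?T *v x)) = signal_embed z x" for x
    by (simp add: tensor_mat_mult_vec signal_embed_def dagger_cancel[OF U(1)]
        flip: oracle_mult_vec[OF Q])
  have compute: "tensor_mat (mat 1) Q *v signal_embed z v = ?k (?T *v v)"
    by (simp add: tensor_mat_mult_vec signal_embed_def oracle_mult_vec[OF Q])
  \<comment> \<open>Only the \<open>|0>\<close> branch of \<open>C |0> w\<close> acquires the phase,
    so the change is \<open>e\<close> times that branch.\<close>
  have "tensor_mat (signal_phase \<phi>) (mat 1) *v (C *v ?k w)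
      = C *v ?k w + e *s ?k (poly_mat Y ?W *v w)" for w
    by (simp add: block matrix_vector_right_distrib tensor_mat_mult_vec signal_phase_ket
        tensor_vec_scale_left e_def vector_sub_rdistrib)
  then have "dagger C *v (tensor_mat (signal_phase \<phi>) (mat 1) *v (C *v ?k (?T *v v)))
      = ?k (?T *v v) + e *s (dagger C *v ?k (poly_mat Y ?W *v (?T *v v)))"
    by (simp add: matrix_vector_right_distrib matrix_vector_mult_scale dagger_cancel[OF U(2)])
  \<comment> \<open>As \<open>C\<^sup>\<dagger>\<close> fixes \<open>|0> f\<close>, the term
    \<open>e * a * f\<close> joins \<open>T v\<close> to form the image under \<open>T\<close> of
    the ideal phase applied to \<open>v\<close>.\<close>
  also have "\<dots> = ?k (?T *v (sel_phase \<phi> (sample_proj \<pi>) *v v))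
      + e *s (dagger C *v ?k (poly_mat Y ?W *v (?T *v r)))"
    by (simp add: YT S tensor_vec_add_right tensor_vec_scale_right matrix_vector_right_distrib
        matrix_vector_mult_scale Cf vector_add_ldistrib)
  finally have "compiled_phase Q C \<phi> *v signal_embed z v
      - signal_embed z (sel_phase \<phi> (sample_proj \<pi>) *v v)
      = e *s ?D (dagger C *v ?k (poly_mat Y ?W *v (?T *v r)))"
    unfolding compiled_phase_def matrix_vector_mul_assoc[symmetric] compute
    by (simp add: matrix_vector_right_distrib matrix_vector_mult_scale uncompute)
  \<comment> \<open>The operators \<open>C\<^sup>\<dagger>\<close> and
    \<open>Q\<^sup>\<dagger>\<close> in front of the error are isometries.\<close>
  then have "norm (compiled_phase Q C \<phi> *v signal_embed z v
      - signal_embed z (sel_phase \<phi> (sample_proj \<pi>) *v v))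
      = cmod e * norm (poly_mat Y ?W *v (?T *v r))"
    using U by (simp add: norm_scale norm_isometry tensor_mat_isometry dagger_one norm_tensor_ket)
  also have "\<dots> \<le> 2 * (\<eta> * norm v)"
  proof (rule mult_mono)
    show "cmod e \<le> 2"
      using norm_triangle_ineq4[of "cis \<phi>" 1] by (simp add: e_def)
    have "braket g (?T *v r) = 0" if "?W *v g = g" for g
      unfolding r_def a_def by (rule szegedy_T_remainder_perp_fixed[OF P \<pi> that])
    then have "norm (poly_mat Y ?W *v (?T *v r)) \<le> \<eta> * norm (?T *v r)"
      using isometry_poly_bound[OF szegedy_walk_isometry[OF P(1)] Y] by blast
    also have "norm (?T *v r) \<le> norm v"
      unfolding norm_isometry[OF dagger_szegedy_T_szegedy_T[OF P(1)]] r_def a_def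
      by (rule norm_remainder_le[OF norm_qsample[OF \<pi>(1)]])
    finally show "norm (poly_mat Y ?W *v (?T *v r)) \<le> \<eta> * norm v"
      using \<open>0 \<le> \<eta>\<close> by (simp add: mult_left_mono)
  qed (use \<open>0 \<le> \<eta>\<close> in auto)
  finally show ?thesis by (simp add: mult_ac)
qed

section \<open>Accumulation of errors\<close>

lemma norm_mat_prod:
  assumes "\<And>j v. norm (F j *v v) = norm v"
  shows "norm (mat_prod m F *v v) = norm v"
proof -
  have "norm (foldr (\<lambda>j M. F j ** M) js (mat 1) *v v) = norm v" for js
    by (induction js) (simp_all add: assms flip: matrix_vector_mul_assoc)
  then show ?thesis by (simp add: mat_prod_def)
qed

text \<open>Peeling off the leftmost factor, the error already made passes through the isometric
  \<open>F j\<close> unamplified, and the new error is measured at a vector that still has the norm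
  of \<open>v\<close>. The errors therefore add up.\<close>

lemma mat_prod_approx:
  fixes J :: "complex ^ 'n \<Rightarrow> complex ^ 'm"
  assumes F: "\<And>j v. norm (F j *v v) = norm v" and G: "\<And>j v. norm (G j *v v) = norm v"
    and FG: "\<And>j v. norm (F j *v J v - J (G j *v v)) \<le> \<delta> * norm v"
  shows "norm (mat_prod m F *v J v - J (mat_prod m G *v v)) \<le> real m * \<delta> * norm v"
proof -
  let ?F = "\<lambda>js. foldr (\<lambda>j M. F j ** M) js (mat 1)" and ?G = "\<lambda>js. foldr (\<lambda>j M. G j ** M) js (mat 1)"
  have norm_G: "norm (?G js *v v) = norm v" for js
    by (induction js) (simp_all add: G flip: matrix_vector_mul_assoc)
  have "norm (?F js *v J v - J (?G js *v v)) \<le> real (length js) * \<delta> * norm v" for js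
  proof (induction js)
    case (Cons j js)
    \<comment> \<open>The hybrid vector \<open>F j *v J (?G js *v v)\<close> is inserted.\<close>
    have "?F (j # js) *v J v - J (?G (j # js) *v v) = F j *v (?F js *v J v - J (?G js *v v))
        + (F j *v J (?G js *v v) - J (G j *v (?G js *v v)))"
      by (simp add: matrix_vector_mult_diff_distrib flip: matrix_vector_mul_assoc)
    also have "norm \<dots> \<le> norm (?F js *v J v - J (?G js *v v)) + \<delta> * norm v"
      using FG[of j "?G js *v v"] norm_G[of js]
      by (intro norm_triangle_le) (simp add: F)
    also have "\<dots> \<le> real (length (j # js)) * \<delta> * norm v"
      using Cons.IH by (simp add: algebra_simps)
    finally show ?case .
  qed simp
  from this[of "[1..<Suc m]"] show ?thesis
    by (simp add: mat_prod_def del: upt_Suc)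
qed

lemma braket_signal_embed: "braket (signal_embed z u) (signal_embed z v) = braket u v"
  by (simp add: signal_embed_def braket_tensor_vec braket_ket)

lemma norm_signal_embed: "norm (signal_embed z v) = norm v"
  by (simp add: signal_embed_def norm_tensor_ket)

text \<open>Each of the \<open>(L - 1) div 2\<close> iterations has two compiled phases of error
  \<open>2 * \<eta>\<close>, hence \<open>4 * \<eta>\<close> per iteration.\<close>

lemma gqsp_fpaa_approx:
  assumes P: "stochastic P" "chain_irreducible P" and \<pi>: "prob_vec \<pi>" "reversible_wrt P \<pi>"
    and P': "stochastic P'" "chain_irreducible P'" and \<pi>': "prob_vec \<pi>'" "reversible_wrt P' \<pi>'"
    and Q: "is_oracle z P Q" and C: "is_gqsp (szegedy_walk P) \<eta> C"
    and Q': "is_oracle z P' Q'" and C': "is_gqsp (szegedy_walk P') \<eta> C'" and "0 \<le> \<eta>"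
  shows "norm (gqsp_fpaa L \<alpha> \<beta> Q C Q' C' *v signal_embed z v
      - signal_embed z (fpaa L \<alpha> \<beta> \<pi> \<pi>' *v v)) \<le> real ((L - 1) div 2) * (4 * \<eta>) * norm v"
  unfolding gqsp_fpaa_def fpaa_def
proof (rule mat_prod_approx)
  have U: "unitary Q" "unitary C" "unitary Q'" "unitary C'"
    using Q C Q' C' by (simp_all add: is_oracle_def is_gqsp_def)
  let ?F = "\<lambda>j. compiled_phase Q C (\<alpha> j)" and ?F' = "\<lambda>j. compiled_phase Q' C' (\<beta> j)"
  let ?G = "\<lambda>j. sel_phase (\<alpha> j) (sample_proj \<pi>)" and ?G' = "\<lambda>j. sel_phase (\<beta> j) (sample_proj \<pi>')"
  fix j v
  show "norm ((?F' j ** ?F j) *v v) = norm v" for v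
    by (simp add: norm_compiled_phase U flip: matrix_vector_mul_assoc)
  have G: "norm (?G j *v v) = norm v" for v
    unfolding sample_proj_def by (rule norm_sel_phase[OF norm_qsample[OF \<pi>(1)]])
  have G': "norm (?G' j *v v) = norm v" for v
    unfolding sample_proj_def by (rule norm_sel_phase[OF norm_qsample[OF \<pi>'(1)]])
  show "norm ((?G' j ** ?G j) *v v) = norm v"
    by (simp add: G G' flip: matrix_vector_mul_assoc)
  \<comment> \<open>The intermediate vector applies the ideal phase first and the compiled one
    second.\<close>
  have "(?F' j ** ?F j) *v signal_embed z v - signal_embed z ((?G' j ** ?G j) *v v)
      = ?F' j *v (?F j *v signal_embed z v - signal_embed z (?G j *v v))
      + (?F' j *v signal_embed z (?G j *v v) - signal_embed z (?G' j *v (?G j *v v)))"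
    by (simp add: matrix_vector_mult_diff_distrib flip: matrix_vector_mul_assoc)
  also have "norm \<dots> \<le> 2 * \<eta> * norm v + 2 * \<eta> * norm (?G j *v v)"
    using compiled_phase_approx[OF P \<pi> Q C \<open>0 \<le> \<eta>\<close>, of "\<alpha> j" v]
      compiled_phase_approx[OF P' \<pi>' Q' C' \<open>0 \<le> \<eta>\<close>, of "\<beta> j" "?G j *v v"]
    by (intro norm_triangle_le add_mono) (simp_all add: norm_compiled_phase U)
  finally show "norm ((?F' j ** ?F j) *v signal_embed z v - signal_embed z ((?G' j ** ?G j) *v v))
      \<le> 4 * \<eta> * norm v"
    by (simp add: G)
qed

theorem mainTheorem4:
  fixes P P' :: "real ^ 'w::finite ^ 'w"
    and \<pi> \<pi>' :: "real ^ 'w"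
    and z :: 'w
    and p \<epsilon>FP \<epsilon>W :: real
    and L :: nat
    and \<alpha> \<beta> :: "nat \<Rightarrow> real"
    and Q Q' :: "complex ^ ('w \<times> 'w) ^ ('w \<times> 'w)"
    and C C' :: "complex ^ (2 \<times> ('w \<times> 'w)) ^ (2 \<times> ('w \<times> 'w))"
  assumes "ergodic_chain P" and "stationary_dist P \<pi>" and "reversible_wrt P \<pi>"
    and "ergodic_chain P'" and "stationary_dist P' \<pi>'" and "reversible_wrt P' \<pi>'"
    and "p > 0" and "(cmod (braket (qsample \<pi>) (qsample \<pi>')))\<^sup>2 \<ge> p"
    and "0 < \<epsilon>FP" and "\<epsilon>FP < 1" and "0 < \<epsilon>W" and "\<epsilon>W < 1"
    and "odd L"
    and "trace_dist (fpaa L \<alpha> \<beta> \<pi> \<pi>' *v qsample \<pi>) (qsample \<pi>') \<le> \<epsilon>FP"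
    and "is_oracle z P Q" and "is_gqsp (szegedy_walk P) \<epsilon>W C"
    and "is_oracle z P' Q'" and "is_gqsp (szegedy_walk P') \<epsilon>W C'"
  shows "trace_dist (gqsp_fpaa L \<alpha> \<beta> Q C Q' C' *v signal_embed z (qsample \<pi>)) (signal_embed z (qsample \<pi>'))
           \<le> 2 * (real L - 1) * \<epsilon>W + \<epsilon>FP"
proof -
  have chain: "stochastic P" "chain_irreducible P" "stochastic P'" "chain_irreducible P'"
    and prob: "prob_vec \<pi>" "prob_vec \<pi>'"
    using assms(1,2,4,5) by (simp_all add: ergodic_chain_def stationary_dist_def)
  have unitary: "unitary Q" "unitary C" "unitary Q'" "unitary C'"
    using assms(15-18) by (simp_all add: is_oracle_def is_gqsp_def)
  let ?b = "fpaa L \<alpha> \<beta> \<pi> \<pi>' *v qsample \<pi>"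
  let ?a = "gqsp_fpaa L \<alpha> \<beta> Q C Q' C' *v signal_embed z (qsample \<pi>)"
  \<comment> \<open>Both outputs must be unit vectors for the trace distance to be the norm of a
    remainder.\<close>
  have "norm ?b = norm (qsample \<pi>)"
    unfolding fpaa_def
    by (rule norm_mat_prod)
      (simp add: sample_proj_def norm_sel_phase norm_qsample prob flip: matrix_vector_mul_assoc)
  moreover have "norm ?a = norm (signal_embed z (qsample \<pi>))"
    unfolding gqsp_fpaa_def
    by (rule norm_mat_prod) (simp add: norm_compiled_phase unitary flip: matrix_vector_mul_assoc)
  ultimately have "trace_dist ?a (signal_embed z (qsample \<pi>'))
      \<le> norm (?a - signal_embed z ?b) + trace_dist (signal_embed z ?b) (signal_embed z (qsample \<pi>'))"
    by (intro trace_dist_perturb) (simp_all add: norm_signal_embed norm_qsample prob)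
  also have "norm (?a - signal_embed z ?b) \<le> real ((L - 1) div 2) * (4 * \<epsilon>W) * norm (qsample \<pi>)"
    using assms(3,6,11,15-18) chain prob by (intro gqsp_fpaa_approx) auto
  \<comment> \<open>For odd \<open>L\<close> the division by 2 is exact, and half of
    \<open>L - 1\<close> times 4 gives the constant 2.\<close>
  also have "\<dots> = 2 * (real L - 1) * \<epsilon>W"
    using \<open>odd L\<close> by (auto simp: norm_qsample prob elim!: oddE)
  \<comment> \<open>The embedding preserves inner products, so this is the trace distance of the
    ideal algorithm.\<close>
  also have "trace_dist (signal_embed z ?b) (signal_embed z (qsample \<pi>')) \<le> \<epsilon>FP"
    using assms(14) by (simp add: trace_dist_def braket_signal_embed)
  finally show ?thesis
    by simp
qed

end
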